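(* Let $m\in\mathbb{N}$, and let $E_1,\dots,E_m$ and $F$ be Banach spaces. Then $\mathcal{L}_{DP}^{\mathrm{ev}}(E_1,\dots,E_m;F)\subset\mathcal{L}_{WDP}^{\mathrm{ev}}(E_1,\dots,E_m;F)$.
   Context: Banach spaces are over $\mathbb{K}=\mathbb{R}$ or $\mathbb{C}$; $F'$ is the topological dual of $F$; $\overset{w}{\to}$ denotes weak convergence of sequences (in $F'$ this means $\sigma(F',F'')$); $\mathcal{L}(E_1,\dots,E_m;F)$ is the space of continuous $m$-linear operators. $T\in\mathcal{L}_{DP}^{\mathrm{ev}}(E_1,\dots,E_m;F)$ if $T\in\mathcal{L}(E_1,\dots,E_m;F)$ and for all $(a_1,\dots,a_m)\in E_1\times\cdots\times E_m$ and all sequences $x_j^{(i)}\overset{w}{\to}a_i$ in $E_i$ ($i=1,\dots,m$), $T(x_j^{(1)},\dots,x_j^{(m)})\to T(a_1,\dots,a_m)$ in norm. $T\in\mathcal{L}_{WDP}^{\mathrm{ev}}(E_1,\dots,E_m;F)$ if $T\in\mathcal{L}(E_1,\dots,E_m;F)$ and for all $(a_1,\dots,a_m)$, all sequences $x_j^{(i)}\overset{w}{\to}a_i$ in $E_i$ ($i=1,\dots,m$), and all sequences $f_j\overset{w}{\to}f$ in $F'$ with $f\in F'$, one has $f_j(T(x_j^{(1)},\dots,x_j^{(m)}))\to f(T(a_1,\dots,a_m))$. *)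

theory Defs
  imports "HOL-Analysis.Analysis" "HOL-Algebra.Module" "HOL-Algebra.Algebraic_Closure_Type"
begin

text \<open>
  The spaces $E_1, \dots, E_m$ are different spaces and their number $m$ varies, so normed spaces
  are records with an explicit carrier and a family of spaces is a function from indices to
  records.  The members of a family have their carriers inside one type, but each has its own
  operations and norm; since the type is arbitrary (for instance a disjoint union), this does not
  restrict the family.

  The scalars form a type of class \<^class>\<open>real_normed_field\<close>. Since the norm is multiplicative,
  the Gelfand--Mazur theorem shows that such a field is isometrically isomorphic to the real or to
  the complex numbers, and both are instances of the class.

  The fields \<^term>\<open>monoid.mult\<close> and \<^term>\<open>monoid.one\<close> inherited from the ring record play no
  role for modules.
\<close>

record ('k, 'a) normed_module = "('k, 'a) module" +
  nrm :: "'a \<Rightarrow> real"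

locale normed_space =
  module "ring_of_type_algebra :: 'k::real_normed_field ring" E
  for E :: "('k::real_normed_field, 'a) normed_module" (structure) +
  assumes nrm_nonneg: "x \<in> carrier E \<Longrightarrow> 0 \<le> nrm E x"
    and nrm_eq_zero_iff: "x \<in> carrier E \<Longrightarrow> nrm E x = 0 \<longleftrightarrow> x = \<zero>"
    and nrm_smult: "x \<in> carrier E \<Longrightarrow> nrm E (c \<odot> x) = norm c * nrm E x"
    and nrm_triangle:
      "x \<in> carrier E \<Longrightarrow> y \<in> carrier E \<Longrightarrow> nrm E (x \<oplus> y) \<le> nrm E x + nrm E y"

text \<open>The locale \<^locale>\<open>Metric_space\<close> requires symmetry and nonnegativity also for points outside
  the carrier, hence the value 0 there.\<close>

definition norm_dist :: "('k, 'a) normed_module \<Rightarrow> 'a \<Rightarrow> 'a \<Rightarrow> real" where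
  "norm_dist E x y =
    (if x \<in> carrier E \<and> y \<in> carrier E then nrm E (x \<ominus>\<^bsub>E\<^esub> y) else 0)"

definition norm_topology :: "('k, 'a) normed_module \<Rightarrow> 'a topology" where
  "norm_topology E = Metric_space.mtopology (carrier E) (norm_dist E)"

definition banach_space :: "('k::real_normed_field, 'a) normed_module \<Rightarrow> bool" where
  "banach_space E \<longleftrightarrow>
    normed_space E \<and> Metric_space.mcomplete (carrier E) (norm_dist E)"

definition linear_op ::
  "('k, 'a) normed_module \<Rightarrow> ('k, 'b) normed_module \<Rightarrow> ('a \<Rightarrow> 'b) \<Rightarrow> bool" where
  "linear_op E F f \<longleftrightarrow>
    f \<in> carrier E \<rightarrow> carrier F \<and>
    (\<forall>x\<in>carrier E. \<forall>y\<in>carrier E. f (x \<oplus>\<^bsub>E\<^esub> y) = f x \<oplus>\<^bsub>F\<^esub> f y) \<and>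
    (\<forall>c. \<forall>x\<in>carrier E. f (c \<odot>\<^bsub>E\<^esub> x) = c \<odot>\<^bsub>F\<^esub> f x)"

text \<open>Functionals are restricted to the carrier, so that equal functionals are equal functions.\<close>

definition dual_space ::
  "('k::real_normed_field, 'a) normed_module \<Rightarrow> ('k, 'a \<Rightarrow> 'k) normed_module" where
  "dual_space E =
    \<lparr> carrier = {f \<in> extensional (carrier E).
        (\<forall>x\<in>carrier E. \<forall>y\<in>carrier E. f (x \<oplus>\<^bsub>E\<^esub> y) = f x + f y) \<and>
        (\<forall>c. \<forall>x\<in>carrier E. f (c \<odot>\<^bsub>E\<^esub> x) = c * f x) \<and>
        continuous_map (norm_topology E) euclidean f},
      monoid.mult = undefined,
      one = undefined,
      ring.zero = (\<lambda>x\<in>carrier E. 0),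
      add = (\<lambda>f g. \<lambda>x\<in>carrier E. f x + g x),
      smult = (\<lambda>c f. \<lambda>x\<in>carrier E. c * f x),
      nrm = (\<lambda>f. SUP x\<in>{x \<in> carrier E. nrm E x \<le> 1}. norm (f x)) \<rparr>"

text \<open>For \<^term>\<open>E = dual_space F\<close> this is convergence in $\sigma(F', F'')$, not in
  $\sigma(F', F)$.\<close>

definition weakly_converges ::
  "('k::real_normed_field, 'a) normed_module \<Rightarrow> (nat \<Rightarrow> 'a) \<Rightarrow> 'a \<Rightarrow> bool" where
  "weakly_converges E x a \<longleftrightarrow>
    (\<forall>j. x j \<in> carrier E) \<and> a \<in> carrier E \<and>
    (\<forall>\<phi>\<in>carrier (dual_space E). (\<lambda>j. \<phi> (x j)) \<longlonglongrightarrow> \<phi> a)"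

text \<open>An $m$-tuple is a function restricted to \<^term>\<open>{1..m}\<close>.\<close>

definition multilinear_ops ::
  "nat \<Rightarrow> (nat \<Rightarrow> ('k, 'a) normed_module) \<Rightarrow> ('k, 'b) normed_module
    \<Rightarrow> ((nat \<Rightarrow> 'a) \<Rightarrow> 'b) set" where
  "multilinear_ops m E F =
    {T \<in> (\<Pi>\<^sub>E i\<in>{1..m}. carrier (E i)) \<rightarrow>\<^sub>E carrier F.
      (\<forall>i\<in>{1..m}. \<forall>x\<in>(\<Pi>\<^sub>E i\<in>{1..m}. carrier (E i)).
        linear_op (E i) F (\<lambda>y. T (x(i := y)))) \<and>
      continuous_map (product_topology (\<lambda>i. norm_topology (E i)) {1..m}) (norm_topology F) T}"

definition DP_ev ::
  "nat \<Rightarrow> (nat \<Rightarrow> ('k::real_normed_field, 'a) normed_module) \<Rightarrow> ('k, 'b) normed_module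
    \<Rightarrow> ((nat \<Rightarrow> 'a) \<Rightarrow> 'b) set" where
  "DP_ev m E F =
    {T \<in> multilinear_ops m E F.
      \<forall>a \<in> (\<Pi>\<^sub>E i\<in>{1..m}. carrier (E i)). \<forall>x :: nat \<Rightarrow> nat \<Rightarrow> 'a.
        (\<forall>i\<in>{1..m}. weakly_converges (E i) (x i) (a i)) \<longrightarrow>
        limitin (norm_topology F) (\<lambda>j. T (\<lambda>i\<in>{1..m}. x i j)) (T a) sequentially}"

definition WDP_ev ::
  "nat \<Rightarrow> (nat \<Rightarrow> ('k::real_normed_field, 'a) normed_module) \<Rightarrow> ('k, 'b) normed_module
    \<Rightarrow> ((nat \<Rightarrow> 'a) \<Rightarrow> 'b) set" where
  "WDP_ev m E F =
    {T \<in> multilinear_ops m E F.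
      \<forall>a \<in> (\<Pi>\<^sub>E i\<in>{1..m}. carrier (E i)). \<forall>x :: nat \<Rightarrow> nat \<Rightarrow> 'a.
      \<forall>f :: nat \<Rightarrow> 'b \<Rightarrow> 'k. \<forall>g :: 'b \<Rightarrow> 'k.
        (\<forall>i\<in>{1..m}. weakly_converges (E i) (x i) (a i)) \<longrightarrow>
        weakly_converges (dual_space F) f g \<longrightarrow>
        (\<lambda>j. f j (T (\<lambda>i\<in>{1..m}. x i j))) \<longlonglongrightarrow> g (T a)}"

end

theory Submission
  imports Defs
begin

text \<open>
  Evaluation at a point of $F$ belongs to $F''$, so a sequence $f_j \to f$ converging weakly in
  $F'$ converges pointwise and, $F$ being complete, is norm bounded by the uniform boundedness
  principle.  If moreover $y_j \to y$ in norm, then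
  $f_j(y_j) = f_j(y_j - y) + f_j(y) \to f(y)$; apply this to $y_j = T(x_j^{(1)}, \dots, x_j^{(m)})$.
\<close>

text \<open>The algebraic half of membership in \<open>dual_space\<close>, kept apart from
  continuity and from extensionality so that the two can be related and checked separately.
  \<open>linear_op\<close> does not fit here, since the target is the scalar type itself and not a
  module record.\<close>

definition linear_functional ::
  "('k::real_normed_field, 'a) normed_module \<Rightarrow> ('a \<Rightarrow> 'k) \<Rightarrow> bool" where
  "linear_functional E f \<longleftrightarrow>
    (\<forall>x\<in>carrier E. \<forall>y\<in>carrier E. f (x \<oplus>\<^bsub>E\<^esub> y) = f x + f y) \<and>
    (\<forall>c. \<forall>x\<in>carrier E. f (c \<odot>\<^bsub>E\<^esub> x) = c * f x)"

section \<open>Arithmetic and metric of a normed space\<close>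

context normed_space
begin

text \<open>\<open>ring_of_type_algebra\<close> only packages the scalar type as a ring record.
  Unfolding it here and in the next lemmas restates the module laws with the class operations on
  scalars.\<close>

lemma smult_closed' [simp, intro]: "x \<in> carrier E \<Longrightarrow> c \<odot> x \<in> carrier E"
  by (rule smult_closed) (simp_all add: ring_of_type_algebra_def)

lemma smult_zero_left: "x \<in> carrier E \<Longrightarrow> 0 \<odot> x = \<zero>"
  using smult_l_null[of x] by (simp add: ring_of_type_algebra_def)

lemma smult_minus_one: "x \<in> carrier E \<Longrightarrow> (- 1) \<odot> x = \<ominus> x"
proof -
  assume x: "x \<in> carrier E"
  have one: "1 \<odot> x = x"
    using smult_one[OF x] by (simp add: ring_of_type_algebra_def)
  have "(- 1) \<odot> x \<oplus> 1 \<odot> x = (- 1 + 1) \<odot> x"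
    using smult_l_distr[of "- 1" 1 x] x by (simp add: ring_of_type_algebra_def)
  then have "(- 1) \<odot> x \<oplus> x = \<zero>"
    using x by (simp add: one smult_zero_left)
  then show ?thesis
    using x minus_equality[of "(- 1) \<odot> x" x] by simp
qed

lemma nrm_zero [simp]: "nrm E \<zero> = 0"
  by (simp add: nrm_eq_zero_iff)

lemma nrm_a_inv: "x \<in> carrier E \<Longrightarrow> nrm E (\<ominus> x) = nrm E x"
  using nrm_smult[of x "- 1"] by (simp add: smult_minus_one)

sublocale Metric: Metric_space "carrier E" "norm_dist E"
proof
  fix x y z
  show "0 \<le> norm_dist E x y"
    by (simp add: norm_dist_def nrm_nonneg)
  show "norm_dist E x y = norm_dist E y x"
    using nrm_a_inv[of "x \<ominus> y"]
    by (auto simp: norm_dist_def minus_eq minus_add a_comm)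
  assume x: "x \<in> carrier E" and y: "y \<in> carrier E"
  \<comment> \<open>If x \<ominus> y is zero, then x is an additive inverse of \<ominus> y, and
    uniqueness of inverses gives x = y.\<close>
  show "norm_dist E x y = 0 \<longleftrightarrow> x = y"
    using x y minus_equality[of x "\<ominus> y"] r_neg[of y]
    by (auto simp: norm_dist_def nrm_eq_zero_iff minus_eq)
  assume z: "z \<in> carrier E"
  have "x \<ominus> z = (x \<ominus> y) \<oplus> (y \<ominus> z)"
    using x y z by (simp add: minus_eq a_assoc r_neg2 r_neg1)
  then show "norm_dist E x z \<le> norm_dist E x y + norm_dist E y z"
    using nrm_triangle[of "x \<ominus> y" "y \<ominus> z"] x y z by (simp add: norm_dist_def)
qed

lemma mball_eq:
  "Metric.mball x r = {y. x \<in> carrier E \<and> y \<in> carrier E \<and> nrm E (x \<ominus> y) < r}"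
  by (auto simp: norm_dist_def)

section \<open>Linear functionals: continuity and boundedness\<close>

lemma linear_functional_zero: "linear_functional E f \<Longrightarrow> f \<zero> = 0"
  unfolding linear_functional_def by (metis mult_zero_left smult_zero_left zero_closed)

lemma linear_functional_diff:
  assumes f: "linear_functional E f" and x: "x \<in> carrier E" and y: "y \<in> carrier E"
  shows "f (x \<ominus> y) = f x - f y"
proof -
  have "f (\<ominus> y) = - 1 * f y"
    using f y smult_minus_one[OF y] unfolding linear_functional_def by metis
  then show ?thesis
    using f x y by (simp add: linear_functional_def minus_eq)
qed

text \<open>Rescale a nonzero x to norm r/2, which lies strictly inside the open ball, and undo the
  scaling by homogeneity; this produces the factor 2. It serves both for continuity at zero and for
  the ball supplied by Baire's theorem.\<close>

lemma linear_functional_bound_of_ball: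
  assumes f: "linear_functional E f" and r: "0 < r"
    and ball: "\<And>x. x \<in> carrier E \<Longrightarrow> nrm E x < r \<Longrightarrow> norm (f x) \<le> C"
    and x: "x \<in> carrier E"
  shows "norm (f x) \<le> 2 * C / r * nrm E x"
proof (cases "x = \<zero>")
  case True
  then show ?thesis
    using linear_functional_zero[OF f] by simp
next
  case False
  then have pos: "0 < nrm E x"
    using x nrm_nonneg[OF x] nrm_eq_zero_iff[OF x] by linarith
  define c :: 'k where "c = of_real (r / (2 * nrm E x))"
  have c: "norm c = r / (2 * nrm E x)"
    using pos r by (simp add: c_def del: of_real_divide of_real_mult)
  have "nrm E (c \<odot> x) < r"
    using pos r x by (simp add: nrm_smult c)
  then have "norm (f (c \<odot> x)) \<le> C"
    using ball x by simp
  then have "r / (2 * nrm E x) * norm (f x) \<le> C"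
    using f x by (simp add: linear_functional_def norm_mult c)
  then show ?thesis
    using pos r by (simp add: field_simps)
qed

lemma continuous_linear_functional_iff:
  assumes f: "linear_functional E f"
  shows "continuous_map (norm_topology E) euclidean f \<longleftrightarrow>
    (\<exists>C\<ge>0. \<forall>x\<in>carrier E. norm (f x) \<le> C * nrm E x)"
proof -
  \<comment> \<open>The epsilon-delta form of continuity, where \<open>Met_TC\<close> is the metric
    that the scalar type carries as a type class instance.\<close>
  have cont: "continuous_map (norm_topology E) euclidean f \<longleftrightarrow>
    (\<forall>a\<in>carrier E. \<forall>\<epsilon>>0. \<exists>\<delta>>0. \<forall>x. x \<in> carrier E \<and> nrm E (a \<ominus> x) < \<delta> \<longrightarrow>
      norm (f a - f x) < \<epsilon>)"
    using Metric.metric_continuous_map[OF Met_TC.Metric_space_axioms, of f]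
    by (simp add: norm_topology_def norm_dist_def dist_norm cong: conj_cong)
  show ?thesis
  proof
    assume "continuous_map (norm_topology E) euclidean f"
    \<comment> \<open>Continuity at zero with epsilon = 1 already bounds f on a ball, hence
      everywhere by scaling.\<close>
    then have "\<exists>\<delta>>0. \<forall>x. x \<in> carrier E \<and> nrm E (\<zero> \<ominus> x) < \<delta> \<longrightarrow> norm (f \<zero> - f x) < 1"
      using cont by (meson zero_closed zero_less_one)
    then obtain \<delta> where \<delta>: "\<delta> > 0"
      "\<And>x. x \<in> carrier E \<Longrightarrow> nrm E (\<zero> \<ominus> x) < \<delta> \<Longrightarrow> norm (f \<zero> - f x) < 1"
      by blast
    have "norm (f x) \<le> 1" if "x \<in> carrier E" "nrm E x < \<delta>" for x
      using \<delta>(2)[of x] that linear_functional_zero[OF f] by (simp add: minus_eq nrm_a_inv)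
    then have "norm (f x) \<le> 2 * 1 / \<delta> * nrm E x" if "x \<in> carrier E" for x
      using linear_functional_bound_of_ball[OF f \<delta>(1)] that by blast
    then show "\<exists>C\<ge>0. \<forall>x\<in>carrier E. norm (f x) \<le> C * nrm E x"
      using \<delta>(1) by (intro exI[of _ "2 * 1 / \<delta>"]) simp
  next
    assume "\<exists>C\<ge>0. \<forall>x\<in>carrier E. norm (f x) \<le> C * nrm E x"
    then obtain C where C: "C \<ge> 0" "\<And>x. x \<in> carrier E \<Longrightarrow> norm (f x) \<le> C * nrm E x"
      by blast
    show "continuous_map (norm_topology E) euclidean f"
      unfolding cont
    proof (intro ballI allI impI)
      fix a and \<epsilon> :: real
      assume a: "a \<in> carrier E" and \<epsilon>: "\<epsilon> > 0"
      \<comment> \<open>C may be 0, so \<epsilon> is divided by C + 1.\<close>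
      have "norm (f a - f x) < \<epsilon>" if x: "x \<in> carrier E" "nrm E (a \<ominus> x) < \<epsilon> / (C + 1)" for x
      proof -
        have "norm (f a - f x) \<le> C * nrm E (a \<ominus> x)"
          using C(2)[of "a \<ominus> x"] a x linear_functional_diff[OF f a x(1)] by simp
        also have "\<dots> \<le> (C + 1) * nrm E (a \<ominus> x)"
          using a x by (simp add: nrm_nonneg mult_right_mono)
        also have "\<dots> < \<epsilon>"
          using x(2) C(1) by (simp add: field_simps)
        finally show ?thesis .
      qed
      then show "\<exists>\<delta>>0. \<forall>x. x \<in> carrier E \<and> nrm E (a \<ominus> x) < \<delta> \<longrightarrow> norm (f a - f x) < \<epsilon>"
        using \<epsilon> C(1) by (intro exI[of _ "\<epsilon> / (C + 1)"]) auto
    qed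
  qed
qed

section \<open>The dual as a normed space, with continuity expressed by a norm bound\<close>

lemma dual_space_carrier_iff:
  "f \<in> carrier (dual_space E) \<longleftrightarrow> f \<in> extensional (carrier E) \<and> linear_functional E f \<and>
    (\<exists>C\<ge>0. \<forall>x\<in>carrier E. norm (f x) \<le> C * nrm E x)"
proof -
  have "f \<in> carrier (dual_space E) \<longleftrightarrow> f \<in> extensional (carrier E) \<and> linear_functional E f \<and>
    continuous_map (norm_topology E) euclidean f"
    by (auto simp: dual_space_def linear_functional_def)
  then show ?thesis
    using continuous_linear_functional_iff by blast
qed

text \<open>Boundedness of f makes the supremum over the unit ball a genuine upper bound there; a
  nonzero x is then normalised to norm 1.\<close>

lemma norm_dual_apply_le:
  assumes f: "f \<in> carrier (dual_space E)" and x: "x \<in> carrier E"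
  shows "norm (f x) \<le> nrm (dual_space E) f * nrm E x"
proof -
  obtain C where lin: "linear_functional E f"
    and C: "C \<ge> 0" "\<And>x. x \<in> carrier E \<Longrightarrow> norm (f x) \<le> C * nrm E x"
    using f unfolding dual_space_carrier_iff by blast
  have "norm (f y) \<le> C" if "y \<in> carrier E" "nrm E y \<le> 1" for y
    using C(2)[OF that(1)] mult_left_mono[OF that(2) C(1)] by simp
  then have "bdd_above ((\<lambda>x. norm (f x)) ` {x \<in> carrier E. nrm E x \<le> 1})"
    by (auto intro: bdd_aboveI[of _ C])
  then have le: "norm (f y) \<le> nrm (dual_space E) f" if "y \<in> carrier E" "nrm E y \<le> 1" for y
    using that by (auto simp: dual_space_def intro: cSUP_upper)
  show ?thesis
  proof (cases "x = \<zero>")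
    case True
    then show ?thesis
      using linear_functional_zero[OF lin] by simp
  next
    case False
    then have pos: "0 < nrm E x"
      using x nrm_nonneg[OF x] nrm_eq_zero_iff[OF x] by linarith
    define c :: 'k where "c = of_real (1 / nrm E x)"
    have c: "norm c = 1 / nrm E x"
      using pos by (simp add: c_def del: of_real_divide)
    have "norm (f (c \<odot> x)) \<le> nrm (dual_space E) f"
      using pos x by (intro le) (simp_all add: nrm_smult c)
    then have "norm (f x) / nrm E x \<le> nrm (dual_space E) f"
      using lin x by (simp add: linear_functional_def norm_mult c)
    then show ?thesis
      using pos by (simp add: field_simps)
  qed
qed

lemma nrm_dual_leI:
  assumes "\<And>x. x \<in> carrier E \<Longrightarrow> norm (f x) \<le> C * nrm E x" and "0 \<le> C"
  shows "nrm (dual_space E) f \<le> C"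
proof -
  \<comment> \<open>A bound on all elements bounds the real supremum only over a nonempty set, so a
    point of the unit ball is exhibited.\<close>
  have "\<zero> \<in> {x \<in> carrier E. nrm E x \<le> 1}"
    by simp
  moreover have "norm (f x) \<le> C" if "x \<in> carrier E" "nrm E x \<le> 1" for x
    using assms(1)[OF that(1)] mult_left_mono[OF that(2) assms(2)] by simp
  ultimately show ?thesis
    unfolding dual_space_def by (auto intro!: cSUP_least)
qed

text \<open>The zero vector lies in the unit ball, so the supremum dominates
  \<open>norm (f \<zero>)\<close>, itself nonnegative.\<close>

lemma nrm_dual_nonneg: "f \<in> carrier (dual_space E) \<Longrightarrow> 0 \<le> nrm (dual_space E) f"
proof -
  assume f: "f \<in> carrier (dual_space E)"
  obtain C where "C \<ge> 0" "\<And>x. x \<in> carrier E \<Longrightarrow> norm (f x) \<le> C * nrm E x"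
    using f unfolding dual_space_carrier_iff by blast
  then have "norm (f y) \<le> C" if "y \<in> carrier E" "nrm E y \<le> 1" for y
    using mult_left_mono[OF that(2) \<open>C \<ge> 0\<close>] that(1) by fastforce
  then have "norm (f \<zero>) \<le> nrm (dual_space E) f"
    by (auto simp: dual_space_def intro!: cSUP_upper bdd_aboveI[of _ C])
  then show ?thesis
    using norm_ge_zero order_trans by blast
qed

lemma dual_space_simps:
  "zero (dual_space E) = (\<lambda>x\<in>carrier E. 0)"
  "f \<oplus>\<^bsub>dual_space E\<^esub> g = (\<lambda>x\<in>carrier E. f x + g x)"
  "c \<odot>\<^bsub>dual_space E\<^esub> f = (\<lambda>x\<in>carrier E. c * f x)"
  by (simp_all add: dual_space_def)

lemma dual_zero_closed: "(\<lambda>x\<in>carrier E. 0) \<in> carrier (dual_space E)"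
  unfolding dual_space_carrier_iff by (auto simp: linear_functional_def nrm_nonneg)

lemma dual_add_closed:
  assumes f: "f \<in> carrier (dual_space E)" and g: "g \<in> carrier (dual_space E)"
  shows "(\<lambda>x\<in>carrier E. f x + g x) \<in> carrier (dual_space E)"
proof -
  let ?C = "nrm (dual_space E) f + nrm (dual_space E) g"
  have "norm (f x + g x) \<le> ?C * nrm E x" if "x \<in> carrier E" for x
    using norm_dual_apply_le[OF f that] norm_dual_apply_le[OF g that]
      norm_triangle_ineq[of "f x" "g x"] by (simp add: distrib_right)
  moreover have "0 \<le> ?C"
    using f g by (simp add: nrm_dual_nonneg)
  ultimately have "\<exists>C\<ge>0. \<forall>x\<in>carrier E. norm ((\<lambda>x\<in>carrier E. f x + g x) x) \<le> C * nrm E x"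
    by (intro exI[of _ ?C]) simp
  moreover have "linear_functional E (\<lambda>x\<in>carrier E. f x + g x)"
    using f g unfolding dual_space_carrier_iff linear_functional_def
    by (simp add: algebra_simps)
  ultimately show ?thesis
    unfolding dual_space_carrier_iff by simp
qed

lemma dual_smult_closed:
  assumes f: "f \<in> carrier (dual_space E)"
  shows "(\<lambda>x\<in>carrier E. c * f x) \<in> carrier (dual_space E)"
proof -
  let ?C = "norm c * nrm (dual_space E) f"
  have "norm (c * f x) \<le> ?C * nrm E x" if "x \<in> carrier E" for x
    using mult_left_mono[OF norm_dual_apply_le[OF f that], of "norm c"]
    by (simp add: norm_mult mult.assoc)
  moreover have "0 \<le> ?C"
    using f by (simp add: nrm_dual_nonneg)
  ultimately have "\<exists>C\<ge>0. \<forall>x\<in>carrier E. norm ((\<lambda>x\<in>carrier E. c * f x) x) \<le> C * nrm E x"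
    by (intro exI[of _ ?C]) simp
  moreover have "linear_functional E (\<lambda>x\<in>carrier E. c * f x)"
    using f unfolding dual_space_carrier_iff linear_functional_def
    by (simp add: algebra_simps)
  ultimately show ?thesis
    unfolding dual_space_carrier_iff by simp
qed

lemma dual_eqI:
  "f \<in> carrier (dual_space E) \<Longrightarrow> g \<in> carrier (dual_space E) \<Longrightarrow>
    (\<And>x. x \<in> carrier E \<Longrightarrow> f x = g x) \<Longrightarrow> f = g"
  unfolding dual_space_carrier_iff by (auto intro: extensionalityI)

lemma nrm_dual_smult_le:
  assumes f: "f \<in> carrier (dual_space E)"
  shows "nrm (dual_space E) (\<lambda>x\<in>carrier E. c * f x) \<le> norm c * nrm (dual_space E) f"
proof (rule nrm_dual_leI)
  show "norm ((\<lambda>x\<in>carrier E. c * f x) x) \<le> norm c * nrm (dual_space E) f * nrm E x"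
    if "x \<in> carrier E" for x
    using that mult_left_mono[OF norm_dual_apply_le[OF f that], of "norm c"]
    by (simp add: norm_mult mult.assoc)
qed (simp add: f nrm_dual_nonneg)

text \<open>One inequality suffices: for c \<noteq> 0, applying it to the factor
  \<open>inverse c\<close> and the functional c f gives the reverse estimate.\<close>

lemma nrm_dual_smult:
  assumes f: "f \<in> carrier (dual_space E)"
  shows "nrm (dual_space E) (\<lambda>x\<in>carrier E. c * f x) = norm c * nrm (dual_space E) f"
proof (cases "c = 0")
  case True
  then show ?thesis
    using nrm_dual_smult_le[OF f, of c] nrm_dual_nonneg[OF dual_smult_closed[OF f, of c]] by simp
next
  case False
  have "f = (\<lambda>x\<in>carrier E. inverse c * (\<lambda>x\<in>carrier E. c * f x) x)"
    using dual_eqI[OF f dual_smult_closed[OF dual_smult_closed[OF f, of c], of "inverse c"]] False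
    by simp
  then have "nrm (dual_space E) f \<le> inverse (norm c) * nrm (dual_space E) (\<lambda>x\<in>carrier E. c * f x)"
    using nrm_dual_smult_le[OF dual_smult_closed[OF f, of c], of "inverse c"]
    by (simp add: norm_inverse)
  then show ?thesis
    using False nrm_dual_smult_le[OF f, of c] by (simp add: field_simps)
qed

text \<open>Lets every result of this locale be reused with \<open>dual_space E\<close> in place of
  \<open>E\<close>; in particular, membership in the bidual becomes a norm bound.\<close>

lemma dual_normed_space: "normed_space (dual_space E)"
proof -
  have ab: "abelian_group (dual_space E)"
  proof (rule abelian_groupI)
    fix f assume f: "f \<in> carrier (dual_space E)"
    have "(\<lambda>x\<in>carrier E. (- 1) * f x) \<oplus>\<^bsub>dual_space E\<^esub> f = \<zero>\<^bsub>dual_space E\<^esub>"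
      by (auto simp: dual_space_simps)
    then show "\<exists>g\<in>carrier (dual_space E). g \<oplus>\<^bsub>dual_space E\<^esub> f = \<zero>\<^bsub>dual_space E\<^esub>"
      using dual_smult_closed[OF f] by blast
    show "\<zero>\<^bsub>dual_space E\<^esub> \<oplus>\<^bsub>dual_space E\<^esub> f = f"
      using f dual_add_closed[OF dual_zero_closed f] by (intro dual_eqI) (simp_all add: dual_space_simps)
  qed (auto simp: dual_space_simps dual_zero_closed dual_add_closed algebra_simps)
  have "module (ring_of_type_algebra :: 'k ring) (dual_space E)"
  proof (rule moduleI)
    fix f assume f: "f \<in> carrier (dual_space E)"
    show "\<one>\<^bsub>ring_of_type_algebra\<^esub> \<odot>\<^bsub>dual_space E\<^esub> f = f"
      using f dual_smult_closed[OF f, of 1]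
      by (intro dual_eqI) (simp_all add: dual_space_simps ring_of_type_algebra_def)
  qed (auto simp: dual_space_simps ring_of_type_algebra_def dual_smult_closed algebra_simps ab
      cring_from_type_algebra[unfolded ring_of_type_algebra_def])
  then show ?thesis
  proof (intro normed_space.intro normed_space_axioms.intro)
    fix f g and c :: 'k
    assume f: "f \<in> carrier (dual_space E)"
    show "0 \<le> nrm (dual_space E) f"
      using f by (rule nrm_dual_nonneg)
    show "nrm (dual_space E) f = 0 \<longleftrightarrow> f = \<zero>\<^bsub>dual_space E\<^esub>"
    proof
      assume z: "nrm (dual_space E) f = 0"
      show "f = \<zero>\<^bsub>dual_space E\<^esub>"
        using f norm_dual_apply_le[OF f] z
        by (intro dual_eqI) (simp_all add: dual_space_simps dual_zero_closed)
    next
      assume "f = \<zero>\<^bsub>dual_space E\<^esub>"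
      then have "nrm (dual_space E) f \<le> 0"
        by (intro nrm_dual_leI) (simp_all add: dual_space_simps)
      then show "nrm (dual_space E) f = 0"
        using nrm_dual_nonneg[OF f] by simp
    qed
    show "nrm (dual_space E) (c \<odot>\<^bsub>dual_space E\<^esub> f) = norm c * nrm (dual_space E) f"
      using f by (simp add: dual_space_simps nrm_dual_smult)
    assume g: "g \<in> carrier (dual_space E)"
    show "nrm (dual_space E) (f \<oplus>\<^bsub>dual_space E\<^esub> g)
        \<le> nrm (dual_space E) f + nrm (dual_space E) g"
    proof (rule nrm_dual_leI)
      fix x assume x: "x \<in> carrier E"
      then show "norm ((f \<oplus>\<^bsub>dual_space E\<^esub> g) x)
          \<le> (nrm (dual_space E) f + nrm (dual_space E) g) * nrm E x"
        using norm_dual_apply_le[OF f x] norm_dual_apply_le[OF g x]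
          norm_triangle_ineq[of "f x" "g x"] by (simp add: dual_space_simps distrib_right)
    qed (simp add: f g nrm_dual_nonneg)
  qed
qed

section \<open>Weak convergence in the dual and uniform boundedness\<close>

lemma eval_in_bidual:
  assumes y: "y \<in> carrier E"
  shows "(\<lambda>f\<in>carrier (dual_space E). f y) \<in> carrier (dual_space (dual_space E))"
proof -
  interpret dual: normed_space "dual_space E"
    by (rule dual_normed_space)
  \<comment> \<open>The constant is \<open>nrm E y\<close>: the estimate for f at y is read as a
    bound in f with y fixed.\<close>
  have "\<exists>C\<ge>0. \<forall>f\<in>carrier (dual_space E). norm (f y) \<le> C * nrm (dual_space E) f"
    using norm_dual_apply_le y nrm_nonneg[OF y] by (metis mult.commute)
  moreover have "linear_functional (dual_space E) (\<lambda>f\<in>carrier (dual_space E). f y)"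
    using y by (simp add: linear_functional_def dual_space_simps dual_add_closed dual_smult_closed)
  ultimately show ?thesis
    unfolding dual.dual_space_carrier_iff by simp
qed

text \<open>Evaluation at y is one of the bidual functionals against which weak convergence in the
  dual is tested.\<close>

lemma weakly_converges_dual_pointwise:
  assumes w: "weakly_converges (dual_space E) f g" and y: "y \<in> carrier E"
  shows "(\<lambda>j. f j y) \<longlonglongrightarrow> g y"
  using w eval_in_bidual[OF y] unfolding weakly_converges_def by fastforce

text \<open>Baire category argument: pointwise boundedness covers the complete space by countably
  many closed sets on which all \<open>f j\<close> share a bound, so one of them contains a ball,
  and linearity moves that ball to the origin.\<close>

lemma uniform_boundedness:
  fixes f :: "nat \<Rightarrow> 'a \<Rightarrow> 'k"
  assumes complete: "Metric.mcomplete"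
    and f: "\<And>j. f j \<in> carrier (dual_space E)"
    and bounded: "\<And>x. x \<in> carrier E \<Longrightarrow> Bseq (\<lambda>j. f j x)"
  shows "\<exists>K. \<forall>j. \<forall>x\<in>carrier E. norm (f j x) \<le> K * nrm E x"
proof -
  define A where "A n = {x \<in> carrier E. \<forall>j. norm (f j x) \<le> real n}" for n :: nat
  have lin: "linear_functional E (f j)" for j
    using f unfolding dual_space_carrier_iff by blast
  have "closedin Metric.mtopology (A n)" for n
  proof -
    have "closedin Metric.mtopology {x \<in> carrier E. norm (f j x) \<le> real n}" for j
    proof -
      have "continuous_map Metric.mtopology euclidean (f j)"
        using f[of j] by (simp add: dual_space_def norm_topology_def)
      then show ?thesis
        using closedin_continuous_map_preimage[of Metric.mtopology euclidean "f j" "cball 0 (real n)"]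
        by simp
    qed
    moreover have "A n = (\<Inter>j. {x \<in> carrier E. norm (f j x) \<le> real n})"
      unfolding A_def by auto
    ultimately show ?thesis
      by auto
  qed
  moreover have "(\<Union>n. A n) = carrier E"
  proof -
    have "\<exists>n. x \<in> A n" if x: "x \<in> carrier E" for x
    proof -
      obtain K where K: "\<And>j. norm (f j x) \<le> K"
        using bounded[OF x] by (auto simp: Bseq_def)
      obtain n where "K \<le> real n"
        using real_arch_simple by blast
      then show ?thesis
        using x K order_trans unfolding A_def by blast
    qed
    then show ?thesis
      unfolding A_def by blast
  qed
  \<comment> \<open>The union is the whole space, which is its own interior and contains zero. By
    Baire, the sets \<open>A n\<close> cannot all have empty interior.\<close>
  then have "Metric.mtopology interior_of (\<Union>(range A)) \<noteq> {}"
    using interior_of_topspace[of Metric.mtopology] zero_closed by auto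
  ultimately have "\<exists>n. Metric.mtopology interior_of (A n) \<noteq> {}"
    using Metric.metric_Baire_category_alt[OF complete, of "range A"] by auto
  then obtain n a where "a \<in> Metric.mtopology interior_of (A n)"
    by blast
  then obtain U where U: "openin Metric.mtopology U" "a \<in> U" "U \<subseteq> A n"
    unfolding interior_of_def by blast
  then have a: "a \<in> carrier E"
    unfolding A_def by blast
  obtain r where r: "r > 0" "Metric.mball a r \<subseteq> A n"
    using U Metric.openin_mtopology by (meson subset_trans)
  \<comment> \<open>Both a and a \<ominus> x lie in the ball around a, hence in \<open>A n\<close>.
    Since f x = f a - f (a \<ominus> x), each of the two terms contributes at most n.\<close>
  have small: "norm (f j x) \<le> 2 * real n" if x: "x \<in> carrier E" "nrm E x < r" for j x
  proof -
    have "a \<ominus> (a \<ominus> x) = x"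
      using a x by (simp add: minus_eq minus_add r_neg2)
    then have "a \<ominus> x \<in> A n"
      using r(2) a x unfolding mball_eq by auto
    moreover have "a \<in> A n"
      using r a unfolding mball_eq by (auto simp: r_neg minus_eq)
    ultimately have "norm (f j a - f j x) \<le> real n" "norm (f j a) \<le> real n"
      using linear_functional_diff[OF lin a x(1)] unfolding A_def by auto
    then show ?thesis
      using norm_triangle_ineq2[of "f j x" "f j a"] by (simp add: norm_minus_commute)
  qed
  \<comment> \<open>The resulting constant 2 * (2 * n) / r does not depend on j, because n and r
    were fixed for the whole family.\<close>
  show ?thesis
    using linear_functional_bound_of_ball[OF lin r(1) small] by blast
qed

lemma weakly_converges_dual_apply:
  assumes complete: "Metric.mcomplete"
    and w: "weakly_converges (dual_space E) f g"
    and y: "limitin (norm_topology E) y z sequentially" and yE: "\<And>j. y j \<in> carrier E"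
  shows "(\<lambda>j. f j (y j)) \<longlonglongrightarrow> g z"
proof -
  \<comment> \<open>A metric limit places \<open>y j\<close> in the carrier only eventually, and
    \<open>norm_dist\<close> is 0 off the carrier. With \<open>yE\<close> it equals the norm of the
    difference for every j.\<close>
  have z: "z \<in> carrier E" and yz: "(\<lambda>j. nrm E (y j \<ominus> z)) \<longlonglongrightarrow> 0"
    using y yE unfolding norm_topology_def Metric.limitin_metric_dist_null
    by (auto simp: norm_dist_def)
  have f: "\<And>j. f j \<in> carrier (dual_space E)"
    using w unfolding weakly_converges_def by blast
  have lin: "linear_functional E (f j)" for j
    using f unfolding dual_space_carrier_iff by blast
  \<comment> \<open>A convergent scalar sequence is bounded, so weak convergence supplies the
    pointwise bounds for \<open>uniform_boundedness\<close>.\<close>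
  have "Bseq (\<lambda>j. f j x)" if "x \<in> carrier E" for x
    by (intro convergent_imp_Bseq convergentI[OF weakly_converges_dual_pointwise[OF w that]])
  then have "\<exists>K. \<forall>j. \<forall>x\<in>carrier E. norm (f j x) \<le> K * nrm E x"
    by (rule uniform_boundedness[OF complete f])
  then obtain K where K: "\<And>j x. x \<in> carrier E \<Longrightarrow> norm (f j x) \<le> K * nrm E x"
    by blast
  have "(\<lambda>j. f j (y j \<ominus> z)) \<longlonglongrightarrow> 0"
  proof (rule Lim_null_comparison)
    show "\<forall>\<^sub>F j in sequentially. norm (f j (y j \<ominus> z)) \<le> K * nrm E (y j \<ominus> z)"
      using K yE z by simp
    show "(\<lambda>j. K * nrm E (y j \<ominus> z)) \<longlonglongrightarrow> 0"
      using tendsto_mult_right_zero[OF yz] by simp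
  qed
  then have "(\<lambda>j. f j (y j \<ominus> z) + f j z) \<longlonglongrightarrow> 0 + g z"
    by (intro tendsto_add weakly_converges_dual_pointwise[OF w z])
  then show ?thesis
    using linear_functional_diff[OF lin yE z] by simp
qed

end

theorem proposition3p17:
  fixes m :: nat
    and E :: "nat \<Rightarrow> ('k::real_normed_field, 'a) normed_module"
    and F :: "('k, 'b) normed_module"
  assumes "\<And>i. i \<in> {1..m} \<Longrightarrow> banach_space (E i)"
    and "banach_space F"
  shows "DP_ev m E F \<subseteq> WDP_ev m E F"
proof
  fix T assume T: "T \<in> DP_ev m E F"
  then have multi: "T \<in> multilinear_ops m E F"
    unfolding DP_ev_def by blast
  interpret F: normed_space F
    using assms(2) unfolding banach_space_def by blast
  have complete: "F.Metric.mcomplete"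
    using assms(2) unfolding banach_space_def by blast
  have "(\<lambda>j. f j (T (\<lambda>i\<in>{1..m}. x i j))) \<longlonglongrightarrow> g (T a)"
    if a: "a \<in> (\<Pi>\<^sub>E i\<in>{1..m}. carrier (E i))"
      and x: "\<forall>i\<in>{1..m}. weakly_converges (E i) (x i) (a i)"
      and w: "weakly_converges (dual_space F) f g" for a f g and x :: "nat \<Rightarrow> nat \<Rightarrow> 'a"
  proof (rule F.weakly_converges_dual_apply[OF complete w])
    show "limitin (norm_topology F) (\<lambda>j. T (\<lambda>i\<in>{1..m}. x i j)) (T a) sequentially"
      using T a x unfolding DP_ev_def by blast
    \<comment> \<open>Needed for every j, not just eventually. Weak convergence includes that all
      terms lie in the carriers, and \<open>restrict\<close> makes the tuple an element of the
      extensional product on which T is defined.\<close>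
    show "T (\<lambda>i\<in>{1..m}. x i j) \<in> carrier F" for j
    proof -
      have "(\<lambda>i\<in>{1..m}. x i j) \<in> (\<Pi>\<^sub>E i\<in>{1..m}. carrier (E i))"
        using x unfolding weakly_converges_def by (intro restrict_PiE_iff[THEN iffD2]) blast
      then show ?thesis
        using multi unfolding multilinear_ops_def by blast
    qed
  qed
  then show "T \<in> WDP_ev m E F"
    using multi unfolding WDP_ev_def by blast
qed

end
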